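(* Let $\pi=(\pi_{ij})_{1\le i\le I,\,1\le j\le J}$ be the joint distribution of a pair of categorical variables $(X,Y)$ with $X\in\{1,\dots,I\}$, $Y\in\{1,\dots,J\}$, with marginal probabilities $\pi_{i+}$ and $\pi_{+j}$. Suppose $\pi$ is a fixed alternative (not depending on $n$), i.e. $\pi_{ij}=\pi_{i+}\pi_{+j}+c_{ij}$, where the $c_{ij}$ are constants satisfying $\sum_{i=1}^I\sum_{j=1}^J c_{ij}=0$ and $\max_{i,j}|c_{ij}|>0$. Let $D=\sum_{i=1}^I\sum_{j=1}^J(\pi_{ij}-\pi_{i+}\pi_{+j})^2$, and let $\widehat D_n$ and $\widetilde D_n$ be, respectively, its maximum likelihood (plug-in) estimator and its unbiased estimator computed from $n$ i.i.d. observations of $(X,Y)$. Then, as $n\to\infty$, $$\sqrt n\,(\widehat D_n-D)\xrightarrow{d} N\left\{0,\ [\mathrm{vec}^{*}(D')]^{\intercal}\,\Sigma^{*}\,\mathrm{vec}^{*}(D')\right\},$$ $$\sqrt n\,(\widetilde D_n-D)\xrightarrow{d} N\left\{0,\ [\mathrm{vec}^{*}(D')]^{\intercal}\,\Sigma^{*}\,\mathrm{vec}^{*}(D')\right\},$$ where the partial derivatives $D'_{ij}=\partial D/\partial\pi_{ij}$, $(i,j)\neq(I,J)$, are given by $$D'_{ij}=2\sum_{m=1}^{I}\pi_{m+}c_{mJ}+2\sum_{k=1}^{J}\pi_{+k}c_{Ik}-2\sum_{m=1}^{I}\pi_{m+}c_{mj}-2\sum_{k=1}^{J}\pi_{+k}c_{ik}+2c_{ij}-2c_{IJ}\quad\text{for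 } i\ne I,\ j\ne J,$$ $$D'_{Ij}=2\sum_{m=1}^{I}\pi_{m+}c_{mJ}-2\sum_{m=1}^{I}\pi_{m+}c_{mj}+2c_{Ij}-2c_{IJ}\quad\text{for } i=I,\ j\ne J,$$ $$D'_{iJ}=2\sum_{k=1}^{J}\pi_{+k}c_{Ik}-2\sum_{k=1}^{J}\pi_{+k}c_{ik}+2c_{iJ}-2c_{IJ}\quad\text{for } i\ne I,\ j=J.$$
   Context: The dimensions $I,J$ are fixed. Joint probabilities: $\pi_{ij}=P(X=i,Y=j)$; marginals: $\pi_{i+}=\sum_{j}\pi_{ij}$, $\pi_{+j}=\sum_i\pi_{ij}$. From $n$ i.i.d. copies of $(X,Y)$ let $n_{ij}$ be the number of observations equal to $(i,j)$, and set $\widehat\pi_{ij}=n_{ij}/n$, $\widehat\pi_{i+}=\sum_j\widehat\pi_{ij}$, $\widehat\pi_{+j}=\sum_i\widehat\pi_{ij}$. Define $$\widehat D_n=\sum_{i=1}^I\sum_{j=1}^J(\widehat\pi_{ij}-\widehat\pi_{i+}\widehat\pi_{+j})^2$$ and, for $n\ge 4$, $$\begin{aligned}\widetilde D_n={}&\frac{n}{n-3}\sum_{i=1}^I\sum_{j=1}^J(\widehat\pi_{ij}-\widehat\pi_{i+}\widehat\pi_{+j})^2-\frac{4n}{(n-2)(n-3)}\sum_{i=1}^I\sum_{j=1}^J\widehat\pi_{ij}\widehat\pi_{i+}\widehat\pi_{+j}\\&+\frac{n}{(n-1)(n-3)}\left(\sum_{i=1}^I\widehat\pi_{i+}^2+\sum_{j=1}^J\widehat\pi_{+j}^2\right)+\frac{n(3n-2)}{(n-1)(n-2)(n-3)}\left(\sum_{i=1}^I\widehat\pi_{i+}^2\right)\left(\sum_{j=1}^J\widehat\pi_{+j}^2\right)\\&-\frac{n}{(n-1)(n-3)}.\end{aligned}$$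 For an $I\times J$ matrix $A$, $\mathrm{vec}^{*}(A)\in\mathbb R^{IJ-1}$ is the leave-one-out vectorization: stack all columns of $A$ and remove the last element $A_{IJ}$ (so only entries with $(i,j)\ne(I,J)$ matter). $\Sigma^{*}$ is the $(IJ-1)\times(IJ-1)$ covariance matrix of $\mathrm{vec}^{*}(\sqrt n\,\widehat\pi)$, i.e. its entries are $\mathrm{Var}(\sqrt n\,\widehat\pi_{ij})=\pi_{ij}(1-\pi_{ij})$ and $\mathrm{Cov}(\sqrt n\,\widehat\pi_{ij},\sqrt n\,\widehat\pi_{km})=-\pi_{ij}\pi_{km}$ for $(i,j)\neq(k,m)$. $\partial D/\partial\pi_{ij}$ denotes the partial derivative of $D$ viewed as a function of the $IJ-1$ free parameters $\pi_{ij}$, $(i,j)\ne(I,J)$, with $\pi_{IJ}=1-\sum_{(i,j)\ne(I,J)}\pi_{ij}$ substituted. $\xrightarrow{d}$ is convergence in distribution, and $N\{0,0\}$ is read as the point mass at $0$. *)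

theory Defs
  imports "HOL-Probability.Probability" "Jordan_Normal_Form.Matrix"
begin

(* An I x J table is a function nat => nat => real, read on {1..I} x {1..J} only. *)

definition row_marginal :: "nat \<Rightarrow> (nat \<Rightarrow> nat \<Rightarrow> real) \<Rightarrow> nat \<Rightarrow> real" where
  "row_marginal J p i = (\<Sum>j=1..J. p i j)"

definition col_marginal :: "nat \<Rightarrow> (nat \<Rightarrow> nat \<Rightarrow> real) \<Rightarrow> nat \<Rightarrow> real" where
  "col_marginal I p j = (\<Sum>i=1..I. p i j)"

definition dependence :: "nat \<Rightarrow> nat \<Rightarrow> (nat \<Rightarrow> nat \<Rightarrow> real) \<Rightarrow> real" where
  "dependence I J p =
     (\<Sum>i=1..I. \<Sum>j=1..J. (p i j - row_marginal J p i * col_marginal I p j)\<^sup>2)"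

definition cell_count ::
  "(nat \<Rightarrow> 'a \<Rightarrow> nat) \<Rightarrow> (nat \<Rightarrow> 'a \<Rightarrow> nat) \<Rightarrow> nat \<Rightarrow> 'a \<Rightarrow> nat \<Rightarrow> nat \<Rightarrow> nat" where
  "cell_count X Y n \<omega> i j = card {k. k < n \<and> X k \<omega> = i \<and> Y k \<omega> = j}"

definition empirical ::
  "(nat \<Rightarrow> 'a \<Rightarrow> nat) \<Rightarrow> (nat \<Rightarrow> 'a \<Rightarrow> nat) \<Rightarrow> nat \<Rightarrow> 'a \<Rightarrow> nat \<Rightarrow> nat \<Rightarrow> real" where
  "empirical X Y n \<omega> i j = real (cell_count X Y n \<omega> i j) / real n"

definition D_hat ::
  "nat \<Rightarrow> nat \<Rightarrow> (nat \<Rightarrow> 'a \<Rightarrow> nat) \<Rightarrow> (nat \<Rightarrow> 'a \<Rightarrow> nat) \<Rightarrow> nat \<Rightarrow> 'a \<Rightarrow> real" where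
  "D_hat I J X Y n \<omega> = dependence I J (empirical X Y n \<omega>)"

(* The unbiased estimator of dependence I J p. Meaningful for n >= 4 only; the values for n < 4 (division by zero) play no
   role in limits as n tends to infinity. *)
definition D_tilde ::
  "nat \<Rightarrow> nat \<Rightarrow> (nat \<Rightarrow> 'a \<Rightarrow> nat) \<Rightarrow> (nat \<Rightarrow> 'a \<Rightarrow> nat) \<Rightarrow> nat \<Rightarrow> 'a \<Rightarrow> real" where
  "D_tilde I J X Y n \<omega> =
     (let q = empirical X Y n \<omega>; r = row_marginal J q; s = col_marginal I q; N = real n
      in N / (N - 3) * (\<Sum>i=1..I. \<Sum>j=1..J. (q i j - r i * s j)\<^sup>2)
         - 4 * N / ((N - 2) * (N - 3)) * (\<Sum>i=1..I. \<Sum>j=1..J. q i j * r i * s j)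
         + N / ((N - 1) * (N - 3)) * ((\<Sum>i=1..I. (r i)\<^sup>2) + (\<Sum>j=1..J. (s j)\<^sup>2))
         + N * (3 * N - 2) / ((N - 1) * (N - 2) * (N - 3))
             * (\<Sum>i=1..I. (r i)\<^sup>2) * (\<Sum>j=1..J. (s j)\<^sup>2)
         - N / ((N - 1) * (N - 3)))"

(* The table obtained from the I*J-1 free parameters q i j, (i,j) \<noteq> (I,J), by
   substituting the (I,J) entry; the value q I J is ignored. *)
definition complete_table ::
  "nat \<Rightarrow> nat \<Rightarrow> (nat \<Rightarrow> nat \<Rightarrow> real) \<Rightarrow> nat \<Rightarrow> nat \<Rightarrow> real" where
  "complete_table I J q i j =
     (if (i, j) = (I, J)
      then 1 - (\<Sum>(k, m)\<in>{1..I} \<times> {1..J} - {(I, J)}. q k m)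
      else q i j)"

(* D as a function of the single free parameter (i,j), the other ones being kept at p. *)
definition D_slice ::
  "nat \<Rightarrow> nat \<Rightarrow> (nat \<Rightarrow> nat \<Rightarrow> real) \<Rightarrow> nat \<Rightarrow> nat \<Rightarrow> real \<Rightarrow> real" where
  "D_slice I J p i j t = dependence I J (complete_table I J (p(i := (p i)(j := t))))"

definition D_partial ::
  "nat \<Rightarrow> nat \<Rightarrow> (nat \<Rightarrow> nat \<Rightarrow> real) \<Rightarrow> nat \<Rightarrow> nat \<Rightarrow> real" where
  "D_partial I J p i j = deriv (D_slice I J p i j) (p i j)"

(* Column stacking: the 0-based position k holds the entry in row k mod I + 1
   and column k div I + 1; the position I*J-1, i.e. the entry (I,J), is dropped. *)
definition vec_star :: "nat \<Rightarrow> nat \<Rightarrow> (nat \<Rightarrow> nat \<Rightarrow> real) \<Rightarrow> real Matrix.vec" where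
  "vec_star I J A = Matrix.vec (I * J - 1) (\<lambda>k. A (k mod I + 1) (k div I + 1))"

(* Covariance matrix of vec_star applied to sqrt n * empirical, for any n >= 1: the
   indicators of cells a and b have variance p_a (1 - p_a) and covariance - p_a p_b. *)
definition Sigma_star :: "nat \<Rightarrow> nat \<Rightarrow> (nat \<Rightarrow> nat \<Rightarrow> real) \<Rightarrow> real Matrix.mat" where
  "Sigma_star I J p = Matrix.mat (I * J - 1) (I * J - 1)
     (\<lambda>(k, l). let a = p (k mod I + 1) (k div I + 1); b = p (l mod I + 1) (l div I + 1)
               in if k = l then a * (1 - a) else - (a * b))"

definition asymptotic_variance :: "nat \<Rightarrow> nat \<Rightarrow> (nat \<Rightarrow> nat \<Rightarrow> real) \<Rightarrow> real" where
  "asymptotic_variance I J p =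
     scalar_prod (vec_star I J (D_partial I J p))
       (Sigma_star I J p *\<^sub>v vec_star I J (D_partial I J p))"

(* N(mu, v) with variance v \<ge> 0; N(mu, 0) is the point mass at mu. *)
definition normal_law :: "real \<Rightarrow> real \<Rightarrow> real measure" where
  "normal_law \<mu> v =
     (if v = 0 then return borel \<mu> else density lborel (normal_density \<mu> (sqrt v)))"

end

theory Submission
  imports Defs "HOL-Real_Asymp.Real_Asymp"
begin

text \<open>
  Write \<open>e\<close> for the deviation of the empirical table from \<open>p\<close>. Each summand of \<open>D\<close> at \<open>p + e\<close> is the
  square of a quadratic polynomial in \<open>e\<close>, so \<open>D\<close> has an exact expansion: its linear part is
  \<open>\<Sum> g\<^sub>i\<^sub>j e\<^sub>i\<^sub>j\<close>, where \<open>g\<close> is the gradient of \<open>D\<close> in all \<open>I J\<close> cells, and the remainder is at most a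
  constant times \<open>\<Sum> e\<^sub>i\<^sub>j\<^sup>2\<close>, whose expectation is \<open>O(1/n)\<close>. The linear part is a normalised sum of the
  i.i.d. variables \<open>g(X\<^sub>k, Y\<^sub>k)\<close>, to which the central limit theorem applies; the remainder vanishes in
  mean after multiplication by \<open>\<surd>n\<close> and does not affect the characteristic functions in the limit.
  The two estimators differ by a deterministic \<open>O(1/n)\<close>. Finally \<open>D'\<^sub>i\<^sub>j = g\<^sub>i\<^sub>j - g\<^sub>I\<^sub>J\<close>, so the quadratic
  form in \<open>\<Sigma>\<^sup>*\<close> is the variance of \<open>g(X, Y)\<close>: subtracting the constant \<open>g\<^sub>I\<^sub>J\<close> does not change it.
\<close>

section \<open>Normal laws, and limits in distribution under perturbations that are small in
  mean\<close>

lemma real_distribution_normal_law: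
  assumes "v \<ge> 0"
  shows "real_distribution (normal_law \<mu> v)"
proof (cases "v = 0")
  case True
  interpret prob_space "return borel \<mu>" by (rule prob_space_return) simp
  show ?thesis using True by (simp add: normal_law_def real_distribution_def real_distribution_axioms_def prob_space_axioms)
next
  case False
  interpret prob_space "density lborel (normal_density \<mu> (sqrt v))"
    using False assms by (intro prob_space_normal_density) simp
  show ?thesis using False by (simp add: normal_law_def real_distribution_def real_distribution_axioms_def prob_space_axioms)
qed

lemma normal_law_scale:
  assumes "v > 0"
  shows "distr (normal_law 0 1) borel (\<lambda>x. sqrt v * x) = normal_law 0 v"
proof -
  interpret prob_space std_normal_distribution
    using real_dist_normal_dist by (simp add: real_distribution_def)
  have "distributed std_normal_distribution lborel (\<lambda>x. x) (normal_density 0 1)"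
    by (simp add: distributed_def distr_id2)
  from normal_density_affine[OF this, of "sqrt v" 0] assms
  have "distributed std_normal_distribution lborel (\<lambda>x. sqrt v * x) (normal_density 0 (sqrt v))"
    by simp
  then have "distr std_normal_distribution lborel (\<lambda>x. sqrt v * x) = density lborel (normal_density 0 (sqrt v))"
    by (simp add: distributed_def)
  \<comment> \<open>Only the sigma-algebra of the target enters, and \<open>lborel\<close> shares it
    with \<open>borel\<close>.\<close>
  moreover have "distr std_normal_distribution lborel (\<lambda>x. sqrt v * x)
      = distr std_normal_distribution borel (\<lambda>x. sqrt v * x)"
    by (intro distr_cong) auto
  ultimately show ?thesis using assms by (simp add: normal_law_def)
qed

text \<open>Factoring out \<open>iexp y\<close>, which has modulus 1, leaves
  \<open>iexp (x - y) - 1\<close>, to which the Taylor bound of order 0 applies.\<close>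

lemma norm_iexp_diff_le: "norm (iexp x - iexp y) \<le> \<bar>x - y\<bar>"
proof -
  have "iexp x - iexp y = iexp y * (iexp (x - y) - 1)"
    by (simp add: algebra_simps flip: exp_add)
  also have "norm \<dots> = norm (iexp (x - y) - 1)"
    by (simp add: norm_mult)
  finally show ?thesis using iexp_approx1[of "x - y" 0] by simp
qed

lemma char_distr_mult:
  assumes "sets \<nu> = sets borel"
  shows "char (distr \<nu> borel (\<lambda>x. s * x)) t = char \<nu> (t * s)"
proof -
  have [measurable_cong]: "sets \<nu> = sets borel" by fact
  show ?thesis by (simp add: char_def integral_distr mult.assoc)
qed

text \<open>A Slutsky-type statement with the error controlled in mean. Since \<open>iexp\<close> is
  1-Lipschitz, the characteristic functions of \<open>B n\<close> and \<open>s * A n\<close> at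
  \<open>t\<close> eventually differ by at most |t| times the mean of \<open>W n\<close>; Levy's
  continuity theorem turns their common limit into weak convergence. The factor \<open>s\<close>
  serves to undo a normalisation by the standard deviation.\<close>

lemma (in prob_space) weak_conv_m_perturb:
  fixes A B W :: "nat \<Rightarrow> 'a \<Rightarrow> real"
  assumes A [measurable]: "\<And>n. A n \<in> borel_measurable M"
    and B [measurable]: "\<And>n. B n \<in> borel_measurable M"
    and conv: "weak_conv_m (\<lambda>n. distr M borel (A n)) \<nu>" and nu: "real_distribution \<nu>"
    and W: "\<And>n. integrable M (W n)"
    and close: "\<forall>\<^sub>F n in sequentially. \<forall>\<omega>\<in>space M. \<bar>B n \<omega> - s * A n \<omega>\<bar> \<le> W n \<omega>"
    and lim: "(\<lambda>n. expectation (W n)) \<longlonglongrightarrow> 0"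
  shows "weak_conv_m (\<lambda>n. distr M borel (B n)) (distr \<nu> borel (\<lambda>x. s * x))"
proof (rule levy_continuity)
  interpret nu: real_distribution \<nu> by fact
  show "real_distribution (distr M borel (B n))" for n
    by (rule real_distribution_distr) measurable
  show "real_distribution (distr \<nu> borel (\<lambda>x. s * x))"
    by (rule nu.real_distribution_distr) measurable
  fix t
  have ch: "char (distr M borel (f n)) u = expectation (\<lambda>\<omega>. iexp (u * f n \<omega>))"
    if "\<And>n. f n \<in> borel_measurable M" for u n and f :: "nat \<Rightarrow> 'a \<Rightarrow> real"
    using that by (simp add: char_def integral_distr)
  have "(\<lambda>n. char (distr M borel (A n)) (t * s)) \<longlonglongrightarrow> char \<nu> (t * s)"
    by (intro levy_continuity1 nu conv real_distribution_distr A)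
  moreover have "(\<lambda>n. char (distr M borel (B n)) t - char (distr M borel (A n)) (t * s)) \<longlonglongrightarrow> 0"
  proof (rule Lim_null_comparison)
    show "(\<lambda>n. \<bar>t\<bar> * expectation (W n)) \<longlonglongrightarrow> 0"
      using tendsto_mult_right_zero[OF lim] by simp
    show "\<forall>\<^sub>F n in sequentially. norm (char (distr M borel (B n)) t - char (distr M borel (A n)) (t * s))
        \<le> \<bar>t\<bar> * expectation (W n)"
      using close
    proof eventually_elim
      case (elim n)
      have int: "integrable M (\<lambda>\<omega>. iexp (u * f \<omega>))" if "f \<in> borel_measurable M" for u f
        using that by (intro integrable_iexp) auto
      have "norm (char (distr M borel (B n)) t - char (distr M borel (A n)) (t * s))
          = norm (expectation (\<lambda>\<omega>. iexp (t * B n \<omega>) - iexp (t * s * A n \<omega>)))"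
        by (subst Bochner_Integration.integral_diff[OF int int]) (simp_all only: ch A B)
      also have "\<dots> \<le> expectation (\<lambda>\<omega>. norm (iexp (t * B n \<omega>) - iexp (t * s * A n \<omega>)))"
        by (rule integral_norm_bound)
      also have "\<dots> \<le> expectation (\<lambda>\<omega>. \<bar>t\<bar> * W n \<omega>)"
      proof (rule integral_mono)
        show "integrable M (\<lambda>\<omega>. norm (iexp (t * B n \<omega>) - iexp (t * s * A n \<omega>)))"
          by (intro integrable_norm Bochner_Integration.integrable_diff int A B)
        show "integrable M (\<lambda>\<omega>. \<bar>t\<bar> * W n \<omega>)" using W by simp
        fix \<omega> assume "\<omega> \<in> space M"
        have "norm (iexp (t * B n \<omega>) - iexp (t * s * A n \<omega>)) \<le> \<bar>t * (B n \<omega> - s * A n \<omega>)\<bar>"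
          using norm_iexp_diff_le[of "t * B n \<omega>" "t * s * A n \<omega>"] by (simp add: algebra_simps)
        also have "\<dots> \<le> \<bar>t\<bar> * W n \<omega>"
          using elim \<open>\<omega> \<in> space M\<close> by (simp add: abs_mult mult_left_mono)
        finally show "norm (iexp (t * B n \<omega>) - iexp (t * s * A n \<omega>)) \<le> \<bar>t\<bar> * W n \<omega>" .
      qed
      finally show ?case by simp
    qed
  qed
  ultimately have "(\<lambda>n. char (distr M borel (B n)) t) \<longlonglongrightarrow> char \<nu> (t * s)"
    using tendsto_add by fastforce
  then show "(\<lambda>n. char (distr M borel (B n)) t) \<longlonglongrightarrow> char (distr \<nu> borel (\<lambda>x. s * x)) t"
    by (simp add: char_distr_mult nu.events_eq_borel)
qed

section \<open>Independent, identically distributed draws from a finite set\<close>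

text \<open>Measurability into \<open>count_space C\<close> places every value of \<open>Z k\<close>
  in \<open>C\<close>, at every point of the space. For contingency tables, \<open>C\<close> is the
  set of cells and \<open>q\<close> the table.\<close>

locale finite_iid = prob_space M for M :: "'a measure" +
  fixes Z :: "nat \<Rightarrow> 'a \<Rightarrow> 'c" and C :: "'c set" and q :: "'c \<Rightarrow> real"
  assumes finite_C: "finite C"
    and indep_Z: "indep_vars (\<lambda>_. count_space C) Z UNIV"
    and law_Z: "\<And>k z. z \<in> C \<Longrightarrow> prob {\<omega> \<in> space M. Z k \<omega> = z} = q z"
begin

definition mean :: "('c \<Rightarrow> real) \<Rightarrow> real" where
  "mean f = (\<Sum>z\<in>C. q z * f z)"

definition centered_sum :: "('c \<Rightarrow> real) \<Rightarrow> nat \<Rightarrow> 'a \<Rightarrow> real" where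
  "centered_sum f n \<omega> = (\<Sum>k<n. f (Z k \<omega>) - mean f)"

lemma measurable_Z [measurable]: "Z k \<in> measurable M (count_space C)"
  using indep_Z by (auto simp: indep_vars_def)

lemma Z_in: "\<omega> \<in> space M \<Longrightarrow> Z k \<omega> \<in> C"
  using measurable_space[OF measurable_Z] by simp

lemma borel_measurable_Z [measurable]: "(\<lambda>\<omega>. f (Z k \<omega>)) \<in> borel_measurable M"
  by (rule measurable_compose[OF measurable_Z]) simp

lemma borel_measurable_centered_sum [measurable]: "centered_sum f n \<in> borel_measurable M"
  unfolding centered_sum_def by measurable

lemma q_nonneg: "z \<in> C \<Longrightarrow> q z \<ge> 0"
  using law_Z[of z 0] by (metis measure_nonneg)

lemma integrable_Z: "integrable M (\<lambda>\<omega>. f (Z k \<omega>) :: real)"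
proof (rule integrable_const_bound[where B = "\<Sum>z\<in>C. \<bar>f z\<bar>"])
  show "AE \<omega> in M. norm (f (Z k \<omega>)) \<le> (\<Sum>z\<in>C. \<bar>f z\<bar>)"
    using Z_in finite_C by (auto intro!: AE_I2 member_le_sum[where f = "\<lambda>z. \<bar>f z\<bar>"])
qed measurable

text \<open>On the space, \<open>f (Z k \<omega>)\<close> is a finite combination of the indicators
  of the events \<open>Z k \<omega> = z\<close>, whose probabilities are \<open>q z\<close>.\<close>

lemma expectation_Z: "expectation (\<lambda>\<omega>. f (Z k \<omega>)) = mean f"
proof -
  have S: "{\<omega> \<in> space M. Z k \<omega> = z} \<in> sets M" if "z \<in> C" for z
    using measurable_sets[OF measurable_Z, of "{z}" k] that
    by (simp add: vimage_def Int_def conj_commute)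
  have "expectation (\<lambda>\<omega>. f (Z k \<omega>))
      = expectation (\<lambda>\<omega>. \<Sum>z\<in>C. f z * indicator {\<omega> \<in> space M. Z k \<omega> = z} \<omega>)"
  proof (rule Bochner_Integration.integral_cong[OF refl])
    fix \<omega> assume \<omega>: "\<omega> \<in> space M"
    have "(\<Sum>z\<in>C. f z * indicator {\<omega> \<in> space M. Z k \<omega> = z} \<omega>) = (\<Sum>z\<in>C. if z = Z k \<omega> then f z else 0)"
      using \<omega> by (intro sum.cong) (auto simp: indicator_def)
    then show "f (Z k \<omega>) = (\<Sum>z\<in>C. f z * indicator {\<omega> \<in> space M. Z k \<omega> = z} \<omega>)"
      using Z_in[OF \<omega>, of k] finite_C by simp
  qed
  also have "\<dots> = (\<Sum>z\<in>C. f z * q z)"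
    using S by (subst Bochner_Integration.integral_sum) (auto simp: law_Z emeasure_eq_measure)
  finally show ?thesis by (simp add: mean_def mult.commute)
qed

text \<open>A constant is its own expectation, so the total mass 1 of \<open>q\<close> in
  \<open>sum_q\<close> is inherited from the probability measure.\<close>

lemma mean_const: "mean (\<lambda>_. a) = a"
  using expectation_Z[of "\<lambda>_. a" 0] by (simp add: prob_space)

lemma sum_q: "sum q C = 1"
  using mean_const[of 1] by (simp add: mean_def)

lemma mean_diff: "mean (\<lambda>z. f z - g z) = mean f - mean g"
  by (simp add: mean_def right_diff_distrib sum_subtractf)

lemma mean_nonneg: "(\<And>z. z \<in> C \<Longrightarrow> f z \<ge> 0) \<Longrightarrow> mean f \<ge> 0"
  unfolding mean_def by (intro sum_nonneg mult_nonneg_nonneg q_nonneg)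

lemma mean_square_deviation: "mean (\<lambda>z. (f z - mean f)\<^sup>2) = mean (\<lambda>z. (f z)\<^sup>2) - (mean f)\<^sup>2"
proof -
  have "mean (\<lambda>z. (f z - mean f)\<^sup>2)
      = mean (\<lambda>z. (f z)\<^sup>2) - 2 * mean f * mean f + (mean f)\<^sup>2 * sum q C"
    unfolding mean_def[of "\<lambda>z. (f z - mean f)\<^sup>2"] mean_def[of "\<lambda>z. (f z)\<^sup>2"]
    by (subst (2) mean_def)
       (simp add: power2_diff algebra_simps sum.distrib sum_subtractf sum_distrib_left sum_distrib_right)
  then show ?thesis by (simp add: sum_q power2_eq_square)
qed

lemma indep_vars_Z: "indep_vars (\<lambda>_. borel) (\<lambda>k \<omega>. f (Z k \<omega>) :: real) UNIV"
  by (rule indep_vars_compose2[OF indep_Z]) simp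

text \<open>A measure on a finite space is determined by its point masses, and \<open>law_Z\<close>
  prescribes the same ones for every \<open>k\<close>.\<close>

lemma distr_Z: "distr M (count_space C) (Z k) = distr M (count_space C) (Z 0)"
proof (rule measure_eqI_finite)
  fix z assume z: "z \<in> C"
  have "emeasure (distr M (count_space C) (Z k)) {z} = ennreal (q z)" for k
  proof -
    have "Z k -` {z} \<inter> space M = {\<omega> \<in> space M. Z k \<omega> = z}" by auto
    then show ?thesis using z law_Z[OF z, of k]
      by (subst emeasure_distr) (auto simp: emeasure_eq_measure)
  qed
  then show "emeasure (distr M (count_space C) (Z k)) {z} = emeasure (distr M (count_space C) (Z 0)) {z}"
    by simp
qed (auto simp: finite_C)

lemma distr_comp_Z:
  "distr M borel (\<lambda>\<omega>. f (Z k \<omega>) :: real) = distr M borel (\<lambda>\<omega>. f (Z 0 \<omega>))"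
proof -
  have "distr M borel (\<lambda>\<omega>. f (Z k \<omega>)) = distr (distr M (count_space C) (Z k)) borel f" for k
    by (subst distr_distr) (auto simp: comp_def)
  then show ?thesis using distr_Z by metis
qed

lemma expectation_mult_Z:
  assumes "k \<noteq> l"
  shows "expectation (\<lambda>\<omega>. f (Z k \<omega>) * f (Z l \<omega>)) = mean f * mean f"
proof -
  have "indep_vars (\<lambda>_. borel) (\<lambda>k \<omega>. f (Z k \<omega>)) {k, l}"
    by (rule indep_vars_subset[OF indep_vars_Z]) simp
  from indep_vars_lebesgue_integral[OF _ this] assms show ?thesis
    by (simp add: integrable_Z expectation_Z)
qed

lemma integrable_mult_Z: "integrable M (\<lambda>\<omega>. f (Z k \<omega>) * g (Z l \<omega>) :: real)"
proof (rule integrable_const_bound[where B = "(\<Sum>z\<in>C. \<bar>f z\<bar>) * (\<Sum>z\<in>C. \<bar>g z\<bar>)"])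
  show "AE \<omega> in M. norm (f (Z k \<omega>) * g (Z l \<omega>)) \<le> (\<Sum>z\<in>C. \<bar>f z\<bar>) * (\<Sum>z\<in>C. \<bar>g z\<bar>)"
    using Z_in finite_C
    by (auto simp: abs_mult intro!: AE_I2 mult_mono sum_nonneg member_le_sum[where f = "\<lambda>z. \<bar>f z\<bar>"]
        member_le_sum[where f = "\<lambda>z. \<bar>g z\<bar>"])
qed measurable

text \<open>The square is a double sum over pairs of draws of the centred function. Independence and
  centring make the off-diagonal terms vanish in mean; each of the \<open>n\<close> diagonal terms
  contributes one variance.\<close>

lemma
  shows integrable_centered_sum_square: "integrable M (\<lambda>\<omega>. (centered_sum f n \<omega>)\<^sup>2)"
    and expectation_centered_sum_square:
      "expectation (\<lambda>\<omega>. (centered_sum f n \<omega>)\<^sup>2) = real n * mean (\<lambda>z. (f z - mean f)\<^sup>2)"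
proof -
  define g where "g = (\<lambda>z. f z - mean f)"
  have g0: "mean g = 0" by (simp add: g_def mean_diff mean_const)
  have sq: "(\<lambda>\<omega>. (centered_sum f n \<omega>)\<^sup>2) = (\<lambda>\<omega>. \<Sum>k<n. \<Sum>l<n. g (Z k \<omega>) * g (Z l \<omega>))"
    by (simp add: centered_sum_def g_def power2_eq_square sum_product)
  show "integrable M (\<lambda>\<omega>. (centered_sum f n \<omega>)\<^sup>2)"
    unfolding sq by (intro Bochner_Integration.integrable_sum integrable_mult_Z)
  have "expectation (\<lambda>\<omega>. (centered_sum f n \<omega>)\<^sup>2)
      = (\<Sum>k<n. \<Sum>l<n. expectation (\<lambda>\<omega>. g (Z k \<omega>) * g (Z l \<omega>)))"
    unfolding sq by (simp add: Bochner_Integration.integral_sum integrable_mult_Z)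
  also have "\<dots> = (\<Sum>k<n. \<Sum>l<n. if l = k then mean (\<lambda>z. (g z)\<^sup>2) else 0)"
    using expectation_Z[of "\<lambda>z. (g z)\<^sup>2"]
    by (intro sum.cong refl) (auto simp: expectation_mult_Z g0 power2_eq_square)
  finally show "expectation (\<lambda>\<omega>. (centered_sum f n \<omega>)\<^sup>2) = real n * mean (\<lambda>z. (f z - mean f)\<^sup>2)"
    by (simp add: g_def)
qed

text \<open>The perturbation lemma on top of the central limit theorem. Variance zero is treated
  separately: the central limit theorem divides by a positive standard deviation, and the limit
  becomes a point mass.\<close>

theorem delta_method:
  fixes B W :: "nat \<Rightarrow> 'a \<Rightarrow> real"
  assumes B [measurable]: "\<And>n. B n \<in> borel_measurable M"
    and W: "\<And>n. integrable M (W n)"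
    and close: "\<forall>\<^sub>F n in sequentially. \<forall>\<omega>\<in>space M.
      \<bar>B n \<omega> - centered_sum f n \<omega> / sqrt (real n)\<bar> \<le> W n \<omega>"
    and lim: "(\<lambda>n. expectation (W n)) \<longlonglongrightarrow> 0"
  shows "weak_conv_m (\<lambda>n. distr M borel (B n)) (normal_law 0 (mean (\<lambda>z. (f z - mean f)\<^sup>2)))"
proof -
  define v where "v = mean (\<lambda>z. (f z - mean f)\<^sup>2)"
  have v0: "v \<ge> 0" by (simp add: v_def mean_nonneg)
  show ?thesis
  proof (cases "v = 0")
    case False
    with v0 have v: "v > 0" by simp
    have "weak_conv_m (\<lambda>n. distr M borel (\<lambda>\<omega>. (\<Sum>k<n. f (Z k \<omega>) - mean f) / sqrt (real n * (sqrt v)\<^sup>2)))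
        std_normal_distribution"
    proof (rule central_limit_theorem[where \<mu> = "distr M borel (\<lambda>\<omega>. f (Z 0 \<omega>))"])
      show "integrable M (\<lambda>x. (f (Z n x))\<^sup>2)" for n
        by (rule integrable_Z[of "\<lambda>z. (f z)\<^sup>2"])
      show "variance (\<lambda>\<omega>. f (Z n \<omega>)) = (sqrt v)\<^sup>2" for n
        using v0 expectation_Z[of "\<lambda>z. (f z - mean f)\<^sup>2"] by (simp add: expectation_Z v_def)
      show "distr M borel (\<lambda>\<omega>. f (Z n \<omega>)) = distr M borel (\<lambda>\<omega>. f (Z 0 \<omega>))" for n
        by (rule distr_comp_Z)
    qed (use v in \<open>simp_all add: indep_vars_Z expectation_Z\<close>)
    then have clt: "weak_conv_m (\<lambda>n. distr M borel (\<lambda>\<omega>. centered_sum f n \<omega> / sqrt (real n * v)))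
        (normal_law 0 1)"
      using v0 by (simp add: centered_sum_def normal_law_def)
    \<comment> \<open>The factor \<open>sqrt v\<close> cancels the standard deviation in the
      normalisation.\<close>
    have "weak_conv_m (\<lambda>n. distr M borel (B n)) (distr (normal_law 0 1) borel (\<lambda>x. sqrt v * x))"
    proof (rule weak_conv_m_perturb[OF _ B clt _ W _ lim])
      show "\<forall>\<^sub>F n in sequentially. \<forall>\<omega>\<in>space M.
          \<bar>B n \<omega> - sqrt v * (centered_sum f n \<omega> / sqrt (real n * v))\<bar> \<le> W n \<omega>"
        using close v by (simp add: real_sqrt_mult)
    qed (simp_all add: real_distribution_normal_law)
    then show ?thesis using v by (simp add: normal_law_scale v_def)
  next
    case True
    \<comment> \<open>The second moment \<open>n * v\<close> is zero, so the centred sum vanishes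
      almost everywhere.\<close>
    have "AE \<omega> in M. (centered_sum f n \<omega>)\<^sup>2 = 0" for n
      using integral_nonneg_eq_0_iff_AE[OF integrable_centered_sum_square[of f n]]
        expectation_centered_sum_square[of f n] True by (simp add: v_def)
    then have z: "AE \<omega> in M. centered_sum f n \<omega> = 0" for n by simp
    have "real_distribution (return borel (0::real))"
      using real_distribution_normal_law[of 0 0] by (simp add: normal_law_def)
    \<comment> \<open>The perturbation lemma asks for a bound at every point, while the centred sum
      vanishes only almost everywhere. Its absolute value therefore joins the error term, at no cost
      in mean.\<close>
    let ?W = "\<lambda>n \<omega>. W n \<omega> + \<bar>centered_sum f n \<omega> / sqrt (real n)\<bar>"
    have zint: "integrable M (\<lambda>\<omega>. \<bar>centered_sum f n \<omega> / sqrt (real n)\<bar>)"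
      "expectation (\<lambda>\<omega>. \<bar>centered_sum f n \<omega> / sqrt (real n)\<bar>) = 0" for n
    proof -
      have ae: "AE \<omega> in M. \<bar>centered_sum f n \<omega> / sqrt (real n)\<bar> = 0" using z[of n] by simp
      have [measurable]: "(\<lambda>\<omega>. \<bar>centered_sum f n \<omega> / sqrt (real n)\<bar>) \<in> borel_measurable M" by measurable
      show "integrable M (\<lambda>\<omega>. \<bar>centered_sum f n \<omega> / sqrt (real n)\<bar>)"
        using integrable_cong_AE[of "\<lambda>\<omega>. \<bar>centered_sum f n \<omega> / sqrt (real n)\<bar>" M "\<lambda>_. 0"] ae by simp
      show "expectation (\<lambda>\<omega>. \<bar>centered_sum f n \<omega> / sqrt (real n)\<bar>) = 0"
        using integral_cong_AE[of "\<lambda>\<omega>. \<bar>centered_sum f n \<omega> / sqrt (real n)\<bar>" M "\<lambda>_. 0"] ae by simp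
    qed
    \<comment> \<open>With \<open>s = 0\<close> and the zero sequence as \<open>A\<close>, the
      required initial convergence is that of a constant sequence of point masses.\<close>
    have "weak_conv_m (\<lambda>n. distr M borel (B n)) (distr (return borel (0::real)) borel (\<lambda>x. 0 * x))"
    proof (rule weak_conv_m_perturb[where A = "\<lambda>_ _. 0" and W = ?W])
      show "weak_conv_m (\<lambda>n. distr M borel (\<lambda>_. 0)) (return borel (0::real))"
        by (simp add: distr_const weak_conv_m_def weak_conv_def)
      show "real_distribution (return borel (0::real))" by fact
      show "integrable M (?W n)" for n
        by (intro Bochner_Integration.integrable_add W zint)
      show "(\<lambda>n. expectation (?W n)) \<longlonglongrightarrow> 0"
        using lim by (simp only: Bochner_Integration.integral_add[OF W zint(1)] zint(2) add_0_right)
      show "\<forall>\<^sub>F n in sequentially. \<forall>\<omega>\<in>space M. \<bar>B n \<omega> - 0 * 0\<bar> \<le> ?W n \<omega>"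
        using close
      proof eventually_elim
        case (elim n)
        show ?case
        proof
          fix \<omega> assume "\<omega> \<in> space M"
          with elim have "\<bar>B n \<omega> - centered_sum f n \<omega> / sqrt (real n)\<bar> \<le> W n \<omega>" by blast
          then show "\<bar>B n \<omega> - 0 * 0\<bar> \<le> ?W n \<omega>"
            by (simp only: mult_zero_left diff_zero)
        qed
      qed
    qed simp_all
    then show ?thesis
      using True by (simp add: v_def[symmetric] normal_law_def distr_return)
  qed
qed

end

section \<open>Exact expansion of the dependence measure around a table\<close>

definition residual :: "nat \<Rightarrow> nat \<Rightarrow> (nat \<Rightarrow> nat \<Rightarrow> real) \<Rightarrow> nat \<Rightarrow> nat \<Rightarrow> real" where
  "residual I J p i j = p i j - row_marginal J p i * col_marginal I p j"

text \<open>The linear part in \<open>e\<close> of the residual at \<open>p + e\<close>.\<close>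

definition residual_diff ::
  "nat \<Rightarrow> nat \<Rightarrow> (nat \<Rightarrow> nat \<Rightarrow> real) \<Rightarrow> (nat \<Rightarrow> nat \<Rightarrow> real) \<Rightarrow> nat \<Rightarrow> nat \<Rightarrow> real" where
  "residual_diff I J p e i j =
     e i j - row_marginal J p i * col_marginal I e j - row_marginal J e i * col_marginal I p j"

text \<open>All cells count as free parameters here, including \<open>(I, J)\<close>.\<close>

definition dependence_grad :: "nat \<Rightarrow> nat \<Rightarrow> (nat \<Rightarrow> nat \<Rightarrow> real) \<Rightarrow> nat \<Rightarrow> nat \<Rightarrow> real" where
  "dependence_grad I J p i j = 2 * (residual I J p i j
     - (\<Sum>m=1..I. row_marginal J p m * residual I J p m j)
     - (\<Sum>k=1..J. col_marginal I p k * residual I J p i k))"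

text \<open>Marginals are linear in the table, so the product of the marginals of \<open>e\<close>
  is the only quadratic term of a residual. The case \<open>h = 1\<close> yields the remainder
  bound, and variable \<open>h\<close> the directional derivative at 0.\<close>

lemma dependence_shift:
  "dependence I J (\<lambda>i j. p i j + h * e i j) = (\<Sum>i=1..I. \<Sum>j=1..J.
     (residual I J p i j + h * residual_diff I J p e i j
      - h\<^sup>2 * (row_marginal J e i * col_marginal I e j))\<^sup>2)"
  unfolding dependence_def residual_def residual_diff_def row_marginal_def col_marginal_def
  by (simp add: sum.distrib algebra_simps power2_eq_square flip: sum_distrib_left sum_distrib_right)

text \<open>The linear part of the expansion, with the coefficients collected on the entries of
  \<open>e\<close>: interchanging the sums transposes the linear map
  \<open>residual_diff I J p\<close>, and its transpose applied to the residual is half the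
  gradient.\<close>

lemma sum_residual_mult_residual_diff:
  "2 * (\<Sum>i=1..I. \<Sum>j=1..J. residual I J p i j * residual_diff I J p e i j)
   = (\<Sum>i=1..I. \<Sum>j=1..J. dependence_grad I J p i j * e i j)"
proof -
  let ?c = "residual I J p" and ?r = "row_marginal J p" and ?s = "col_marginal I p"
  \<comment> \<open>The row index of the residual becomes \<open>m\<close>, and \<open>i\<close> is
    taken over by the summation inside \<open>col_marginal I e j\<close>.\<close>
  have 1: "(\<Sum>i=1..I. \<Sum>j=1..J. ?c i j * (?r i * col_marginal I e j))
      = (\<Sum>i=1..I. \<Sum>j=1..J. (\<Sum>m=1..I. ?r m * ?c m j) * e i j)"
  proof -
    have "(\<Sum>i=1..I. \<Sum>j=1..J. ?c i j * (?r i * col_marginal I e j))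
        = (\<Sum>j=1..J. \<Sum>m=1..I. \<Sum>i=1..I. ?r m * ?c m j * e i j)"
      unfolding col_marginal_def[of I e]
      by (subst sum.swap) (simp add: sum_distrib_left mult_ac)
    also have "\<dots> = (\<Sum>j=1..J. \<Sum>i=1..I. \<Sum>m=1..I. ?r m * ?c m j * e i j)"
      by (intro sum.cong refl sum.swap)
    also have "\<dots> = (\<Sum>i=1..I. \<Sum>j=1..J. \<Sum>m=1..I. ?r m * ?c m j * e i j)"
      by (rule sum.swap)
    finally show ?thesis by (simp add: sum_distrib_right)
  qed
  have 2: "(\<Sum>i=1..I. \<Sum>j=1..J. ?c i j * (row_marginal J e i * ?s j))
      = (\<Sum>i=1..I. \<Sum>j=1..J. (\<Sum>k=1..J. ?s k * ?c i k) * e i j)"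
  proof -
    have "(\<Sum>i=1..I. \<Sum>j=1..J. ?c i j * (row_marginal J e i * ?s j))
        = (\<Sum>i=1..I. \<Sum>k=1..J. \<Sum>j=1..J. ?s k * ?c i k * e i j)"
      unfolding row_marginal_def[of J e] by (simp add: sum_distrib_left sum_distrib_right mult_ac)
    also have "\<dots> = (\<Sum>i=1..I. \<Sum>j=1..J. \<Sum>k=1..J. ?s k * ?c i k * e i j)"
      by (intro sum.cong refl sum.swap)
    finally show ?thesis by (simp add: sum_distrib_right)
  qed
  have "(\<Sum>i=1..I. \<Sum>j=1..J. ?c i j * residual_diff I J p e i j)
      = (\<Sum>i=1..I. \<Sum>j=1..J. ?c i j * e i j)
        - (\<Sum>i=1..I. \<Sum>j=1..J. ?c i j * (?r i * col_marginal I e j))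
        - (\<Sum>i=1..I. \<Sum>j=1..J. ?c i j * (row_marginal J e i * ?s j))"
    by (simp add: residual_diff_def right_diff_distrib sum_subtractf)
  also have "\<dots> = (\<Sum>i=1..I. \<Sum>j=1..J. dependence_grad I J p i j / 2 * e i j)"
    unfolding 1 2 by (simp add: dependence_grad_def left_diff_distrib sum_subtractf diff_divide_distrib)
  finally show ?thesis by (simp add: sum_distrib_left)
qed

text \<open>A cell contributes the square of \<open>c + l - u v\<close>, where \<open>u v\<close> is
  the product of the marginals of \<open>e\<close>. Removing \<open>c^2\<close> and
  \<open>2 c l\<close> leaves \<open>(l - u v)^2 - 2 c u v\<close>. By Cauchy-Schwarz the squared
  marginals are at most multiples of the sum \<open>T\<close> of the squared entries.\<close>

lemma dependence_remainder:
  fixes p :: "nat \<Rightarrow> nat \<Rightarrow> real"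
  obtains K where "\<And>e. (\<And>i j. i \<in> {1..I} \<Longrightarrow> j \<in> {1..J} \<Longrightarrow> \<bar>e i j\<bar> \<le> 1) \<Longrightarrow>
    \<bar>dependence I J (\<lambda>i j. p i j + e i j) - dependence I J p
      - (\<Sum>i=1..I. \<Sum>j=1..J. dependence_grad I J p i j * e i j)\<bar>
    \<le> K * (\<Sum>i=1..I. \<Sum>j=1..J. (e i j)\<^sup>2)"
proof
  define r where "r = row_marginal J p"
  define s where "s = col_marginal I p"
  define c where "c = residual I J p"
  \<comment> \<open>The first summand is twice the bound for \<open>l^2\<close>, the second twice
    the bound for \<open>(u v)^2\<close>, both from
    \<open>(l - u v)^2 \<le> 2 l^2 + 2 (u v)^2\<close>; the third comes from
    \<open>2 |u v| \<le> u^2 + v^2\<close>.\<close>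
  define k where "k i j = 6 * (1 + (r i)\<^sup>2 * I + (s j)\<^sup>2 * J) + 2 * (real J)\<^sup>2 * I + \<bar>c i j\<bar> * (I + J)" for i j
  fix e :: "nat \<Rightarrow> nat \<Rightarrow> real"
  assume e: "\<And>i j. i \<in> {1..I} \<Longrightarrow> j \<in> {1..J} \<Longrightarrow> \<bar>e i j\<bar> \<le> 1"
  define T where "T = (\<Sum>i=1..I. \<Sum>j=1..J. (e i j)\<^sup>2)"
  define u where "u = row_marginal J e"
  define v where "v = col_marginal I e"
  define l where "l = residual_diff I J p e"
  have T0: "T \<ge> 0" by (simp add: T_def sum_nonneg)
  have cell: "\<bar>(l i j - u i * v j)\<^sup>2 - 2 * c i j * (u i * v j)\<bar> \<le> k i j * T"
    if i: "i \<in> {1..I}" and j: "j \<in> {1..J}" for i j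
  proof -
    have row: "(\<Sum>j=1..J. (e i j)\<^sup>2) \<le> T"
      unfolding T_def using i by (intro member_le_sum[where f = "\<lambda>i. \<Sum>j=1..J. (e i j)\<^sup>2"]) (auto intro: sum_nonneg)
    have T': "T = (\<Sum>j=1..J. \<Sum>i=1..I. (e i j)\<^sup>2)" unfolding T_def by (rule sum.swap)
    have col: "(\<Sum>i=1..I. (e i j)\<^sup>2) \<le> T"
      unfolding T' using j by (intro member_le_sum[where f = "\<lambda>j. \<Sum>i=1..I. (e i j)\<^sup>2"]) (auto intro: sum_nonneg)
    have "(e i j)\<^sup>2 \<le> (\<Sum>j=1..J. (e i j)\<^sup>2)"
      using j by (intro member_le_sum[where f = "\<lambda>j. (e i j)\<^sup>2"]) auto
    with row have ee: "(e i j)\<^sup>2 \<le> T" by simp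
    have "(u i)\<^sup>2 \<le> (\<Sum>j=1..J. (e i j)\<^sup>2) * J"
      unfolding u_def row_marginal_def using sum_squared_le_sum_of_squares[of "e i" "{1..J}"] by simp
    also have "\<dots> \<le> T * J" using row by (intro mult_right_mono) auto
    finally have uu: "(u i)\<^sup>2 \<le> J * T" by (simp add: mult.commute)
    have "(v j)\<^sup>2 \<le> (\<Sum>i=1..I. (e i j)\<^sup>2) * I"
      unfolding v_def col_marginal_def using sum_squared_le_sum_of_squares[of "\<lambda>i. e i j" "{1..I}"] by simp
    also have "\<dots> \<le> T * I" using col by (intro mult_right_mono) auto
    finally have vv: "(v j)\<^sup>2 \<le> I * T" by (simp add: mult.commute)
    \<comment> \<open>The bound 1 on the entries reduces the quartic term \<open>(u v)^2\<close> to
      a multiple of \<open>T\<close>.\<close>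
    have "\<bar>u i\<bar> \<le> (\<Sum>j=1..J. 1)"
      unfolding u_def row_marginal_def using e i by (intro order_trans[OF sum_abs] sum_mono) auto
    then have "(u i)\<^sup>2 \<le> (real J)\<^sup>2"
      by (simp add: abs_le_square_iff[symmetric])
    then have "(u i * v j)\<^sup>2 \<le> (real J)\<^sup>2 * (I * T)"
      unfolding power_mult_distrib using vv by (intro mult_mono) auto
    then have ww: "(u i * v j)\<^sup>2 \<le> (real J)\<^sup>2 * I * T" by (simp add: mult_ac)
    have "2 * \<bar>u i * v j\<bar> \<le> (u i)\<^sup>2 + (v j)\<^sup>2"
      using sum_squares_bound[of "\<bar>u i\<bar>" "\<bar>v j\<bar>"] by (simp add: abs_mult)
    also have "\<dots> \<le> (I + J) * T" using uu vv by (simp add: algebra_simps)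
    finally have "\<bar>c i j\<bar> * (2 * \<bar>u i * v j\<bar>) \<le> \<bar>c i j\<bar> * ((I + J) * T)"
      by (intro mult_left_mono) auto
    then have w: "\<bar>2 * c i j * (u i * v j)\<bar> \<le> \<bar>c i j\<bar> * (I + J) * T"
      by (simp add: abs_mult mult_ac)
    have three: "(x - y - z)\<^sup>2 \<le> 3 * (x\<^sup>2 + y\<^sup>2 + z\<^sup>2)" for x y z :: real
      using sum_squares_bound[of x "-y"] sum_squares_bound[of x "-z"] sum_squares_bound[of y z]
      by (simp add: power2_eq_square algebra_simps)
    have "(l i j)\<^sup>2 \<le> 3 * ((e i j)\<^sup>2 + (r i)\<^sup>2 * (v j)\<^sup>2 + (s j)\<^sup>2 * (u i)\<^sup>2)"
      using three[of "e i j" "r i * v j" "u i * s j"]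
      by (simp add: l_def residual_diff_def r_def s_def u_def v_def power_mult_distrib mult_ac)
    also have "\<dots> \<le> 3 * (T + (r i)\<^sup>2 * (I * T) + (s j)\<^sup>2 * (J * T))"
      using ee uu vv by (intro mult_left_mono add_mono) auto
    finally have ll: "(l i j)\<^sup>2 \<le> 3 * (1 + (r i)\<^sup>2 * I + (s j)\<^sup>2 * J) * T"
      by (simp add: algebra_simps)
    have "(l i j - u i * v j)\<^sup>2 \<le> 2 * (l i j)\<^sup>2 + 2 * (u i * v j)\<^sup>2"
      using zero_le_power2[of "l i j + u i * v j"] by (simp add: power2_eq_square algebra_simps)
    with ll ww have "(l i j - u i * v j)\<^sup>2
        \<le> 6 * (1 + (r i)\<^sup>2 * I + (s j)\<^sup>2 * J) * T + 2 * (real J)\<^sup>2 * I * T"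
      by (simp add: algebra_simps)
    then have "\<bar>(l i j - u i * v j)\<^sup>2 - 2 * c i j * (u i * v j)\<bar>
        \<le> 6 * (1 + (r i)\<^sup>2 * I + (s j)\<^sup>2 * J) * T + 2 * (real J)\<^sup>2 * I * T + \<bar>c i j\<bar> * (I + J) * T"
      using w abs_triangle_ineq4[of "(l i j - u i * v j)\<^sup>2" "2 * c i j * (u i * v j)"] by simp
    then show ?thesis by (simp add: k_def distrib_right)
  qed
  have "dependence I J (\<lambda>i j. p i j + e i j) = (\<Sum>i=1..I. \<Sum>j=1..J. (c i j + l i j - u i * v j)\<^sup>2)"
    using dependence_shift[of I J p 1 e] by (simp add: c_def l_def u_def v_def)
  moreover have "dependence I J p = (\<Sum>i=1..I. \<Sum>j=1..J. (c i j)\<^sup>2)"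
    by (simp add: dependence_def c_def residual_def)
  moreover have "(\<Sum>i=1..I. \<Sum>j=1..J. dependence_grad I J p i j * e i j) = (\<Sum>i=1..I. \<Sum>j=1..J. 2 * c i j * l i j)"
    unfolding sum_residual_mult_residual_diff[symmetric] by (simp add: c_def l_def sum_distrib_left mult_ac)
  ultimately have "dependence I J (\<lambda>i j. p i j + e i j) - dependence I J p
      - (\<Sum>i=1..I. \<Sum>j=1..J. dependence_grad I J p i j * e i j)
      = (\<Sum>i=1..I. \<Sum>j=1..J. (l i j - u i * v j)\<^sup>2 - 2 * c i j * (u i * v j))"
    by (simp only: flip: sum_subtractf) (simp add: power2_eq_square algebra_simps)
  also have "\<bar>\<dots>\<bar> \<le> (\<Sum>i=1..I. \<Sum>j=1..J. k i j * T)"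
    by (intro order_trans[OF sum_abs] sum_mono cell)
  also have "\<dots> = (\<Sum>i=1..I. \<Sum>j=1..J. k i j) * T" by (simp add: sum_distrib_right)
  \<comment> \<open>This fixes the witness for \<open>K\<close>: the sum of \<open>k\<close> over
    all cells, which depends on \<open>p\<close> but not on \<open>e\<close>.\<close>
  finally show "\<bar>dependence I J (\<lambda>i j. p i j + e i j) - dependence I J p
      - (\<Sum>i=1..I. \<Sum>j=1..J. dependence_grad I J p i j * e i j)\<bar>
    \<le> (\<Sum>i=1..I. \<Sum>j=1..J. k i j) * (\<Sum>i=1..I. \<Sum>j=1..J. (e i j)\<^sup>2)" unfolding T_def .
qed

section \<open>Partial derivatives in the free parameters\<close>

lemma dependence_shift_has_derivative:
  "((\<lambda>h. dependence I J (\<lambda>i j. p i j + h * e i j)) has_real_derivative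
     (\<Sum>i=1..I. \<Sum>j=1..J. dependence_grad I J p i j * e i j)) (at 0)"
  unfolding dependence_shift sum_residual_mult_residual_diff[symmetric]
  by (auto intro!: derivative_eq_intros simp: sum_distrib_left mult_ac)

text \<open>Since \<open>p\<close> has total 1, completion at \<open>t = p i j\<close> returns
  \<open>p I J\<close> in the last cell. Any change of the free entry \<open>(i, j)\<close> is
  compensated there by the opposite change.\<close>

lemma complete_table_update:
  fixes p :: "nat \<Rightarrow> nat \<Rightarrow> real"
  assumes total: "(\<Sum>i=1..I. \<Sum>j=1..J. p i j) = 1"
    and i: "i \<in> {1..I}" and j: "j \<in> {1..J}" and ne: "(i, j) \<noteq> (I, J)"
  shows "complete_table I J (p(i := (p i)(j := t))) a b
    = p a b + (t - p i j) * (of_bool ((a, b) = (i, j)) - of_bool ((a, b) = (I, J)))"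
proof -
  let ?C = "{1..I} \<times> {1..J}" and ?f = "\<lambda>(k, m). p k m"
  have IJ: "(I, J) \<in> ?C" using i j by auto
  have "sum ?f ?C = 1" using total by (simp add: sum.cartesian_product)
  then have others: "sum ?f (?C - {(I, J)}) = 1 - p I J"
    using IJ by (subst sum_diff1) auto
  have "(\<Sum>(k, m)\<in>?C - {(I, J)}. (p(i := (p i)(j := t))) k m)
      = (\<Sum>z\<in>?C - {(I, J)}. ?f z + (if z = (i, j) then t - p i j else 0))"
    by (intro sum.cong) (auto split: if_splits)
  also have "\<dots> = 1 - p I J + (t - p i j)"
    using i j ne others by (simp add: sum.distrib del: One_nat_def)
  finally show ?thesis using ne by (auto simp: complete_table_def)
qed

lemma sum_cells_of_bool:
  fixes g :: "nat \<Rightarrow> nat \<Rightarrow> real"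
  assumes "i \<in> {1..I}" "j \<in> {1..J}"
  shows "(\<Sum>a=1..I. \<Sum>b=1..J. g a b * of_bool ((a, b) = (i, j))) = g i j"
proof -
  have "(\<Sum>a=1..I. \<Sum>b=1..J. g a b * of_bool ((a, b) = (i, j)))
      = (\<Sum>z\<in>{1..I} \<times> {1..J}. if z = (i, j) then g i j else 0)"
    unfolding sum.cartesian_product by (intro sum.cong) auto
  then show ?thesis using assms by simp
qed

lemma D_slice_has_derivative:
  assumes total: "(\<Sum>i=1..I. \<Sum>j=1..J. p i j) = 1"
    and i: "i \<in> {1..I}" and j: "j \<in> {1..J}" and ne: "(i, j) \<noteq> (I, J)"
  shows "(D_slice I J p i j has_real_derivative
    dependence_grad I J p i j - dependence_grad I J p I J) (at (p i j))"
proof -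
  let ?e = "\<lambda>a b. of_bool ((a, b) = (i, j)) - of_bool ((a, b) = (I, J))"
  \<comment> \<open>The slice is \<open>dependence\<close> along the line through \<open>p\<close>
    that moves mass from \<open>(I, J)\<close> to \<open>(i, j)\<close>; the directional derivative
    is then a difference of two gradient entries.\<close>
  let ?F = "\<lambda>h. dependence I J (\<lambda>a b. p a b + h * ?e a b)"
  have eq: "D_slice I J p i j = (\<lambda>t. ?F (t - p i j))"
    unfolding D_slice_def complete_table_update[OF assms] ..
  have "(\<Sum>a=1..I. \<Sum>b=1..J. dependence_grad I J p a b * ?e a b)
      = dependence_grad I J p i j - dependence_grad I J p I J"
    using sum_cells_of_bool[OF i j] sum_cells_of_bool[of I I J J] i j
    by (simp add: right_diff_distrib sum_subtractf)
  with dependence_shift_has_derivative[of I J p ?e]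
  have F: "(?F has_real_derivative dependence_grad I J p i j - dependence_grad I J p I J) (at (p i j - p i j))"
    by simp
  have "((\<lambda>t. ?F (t - p i j)) has_real_derivative
      (dependence_grad I J p i j - dependence_grad I J p I J) * 1) (at (p i j))"
    by (rule DERIV_chain2[where f = ?F and g = "\<lambda>t. t - p i j", OF F]) (auto intro!: derivative_eq_intros)
  then show ?thesis by (simp add: eq)
qed

section \<open>Leave-one-out vectorization and the quadratic form of the covariance matrix\<close>

text \<open>The only position decoding to \<open>(I, J)\<close> is
  \<open>(I - 1) + I * (J - 1) = I * J - 1\<close>, just outside the range.\<close>

lemma vec_star_position:
  fixes I J k :: nat
  assumes "I \<ge> 1" "J \<ge> 1" "k < I * J - 1"
  shows "(k mod I + 1, k div I + 1) \<in> {1..I} \<times> {1..J} - {(I, J)}"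
proof -
  have "k < J * I" using assms(3) mult.commute[of I J] by linarith
  then have "k div I < J" by (rule less_mult_imp_div_less)
  moreover have "k mod I < I" using assms by simp
  moreover have "(k mod I + 1, k div I + 1) \<noteq> (I, J)"
  proof
    assume "(k mod I + 1, k div I + 1) = (I, J)"
    then have "k mod I = I - 1" "k div I = J - 1" by auto
    then have "k = (I - 1) + I * (J - 1)" using mod_mult_div_eq[of k I] by simp
    also have "\<dots> = I * J - 1" using assms by (cases I; cases J) auto
    finally show False using assms by simp
  qed
  ultimately show ?thesis by auto
qed

text \<open>Decoding positions is a bijection onto the cells other than \<open>(I, J)\<close>, with
  inverse \<open>(i - 1) + I * (j - 1)\<close>.\<close>

lemma sum_vec_star:
  fixes f :: "nat \<Rightarrow> nat \<Rightarrow> real"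
  assumes "I \<ge> 1" "J \<ge> 1"
  shows "(\<Sum>k=0..<I * J - 1. f (k mod I + 1) (k div I + 1)) = (\<Sum>(i, j)\<in>{1..I} \<times> {1..J} - {(I, J)}. f i j)"
proof (rule sum.reindex_bij_witness[where i = "\<lambda>(i, j). (i - 1) + I * (j - 1)" and j = "\<lambda>k. (k mod I + 1, k div I + 1)"])
  fix k assume k: "k \<in> {0..<I * J - 1}"
  show "(case (k mod I + 1, k div I + 1) of (i, j) \<Rightarrow> (i - 1) + I * (j - 1)) = k" by simp
  show "(k mod I + 1, k div I + 1) \<in> {1..I} \<times> {1..J} - {(I, J)}"
    using k by (intro vec_star_position assms) simp
next
  fix z assume z: "z \<in> {1..I} \<times> {1..J} - {(I, J)}"
  obtain i j where ij: "z = (Suc i, Suc j)" "i < I" "j < J" "(Suc i, Suc j) \<noteq> (I, J)"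
    using z by (cases z; cases "fst z"; cases "snd z") auto
  show "(\<lambda>k. (k mod I + 1, k div I + 1)) (case z of (i, j) \<Rightarrow> (i - 1) + I * (j - 1)) = z"
    using ij by simp
  \<comment> \<open>In the last column the row is not the last one; in any earlier column at least
    one full column still follows.\<close>
  have "i + I * j < I * J - 1"
  proof (cases "Suc j = J")
    case True
    then have "Suc i < I" using ij by auto
    then show ?thesis using True by auto
  next
    case False
    then have "I * (Suc j + 1) \<le> I * J" using ij by (intro mult_left_mono) auto
    then show ?thesis using ij by simp
  qed
  then show "(case z of (i, j) \<Rightarrow> (i - 1) + I * (j - 1)) \<in> {0..<I * J - 1}" using ij by simp
qed auto

text \<open>The matrix is the diagonal matrix of the cell probabilities minus the rank-one matrix of
  their products, which gives the second moment minus the squared first moment. As \<open>d\<close>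
  vanishes at \<open>(I, J)\<close>, the sums may include that cell.\<close>

lemma Sigma_star_quadratic_form:
  assumes "I \<ge> 1" "J \<ge> 1" and d0: "d I J = 0"
  shows "scalar_prod (vec_star I J d) (Sigma_star I J p *\<^sub>v vec_star I J d)
    = (\<Sum>(i, j)\<in>{1..I} \<times> {1..J}. p i j * (d i j)\<^sup>2) - (\<Sum>(i, j)\<in>{1..I} \<times> {1..J}. p i j * d i j)\<^sup>2"
proof -
  let ?i = "\<lambda>k. k mod I + 1" and ?j = "\<lambda>k. k div I + 1" and ?N = "I * J - 1"
  define P where "P k = p (?i k) (?j k)" for k
  define d' where "d' k = d (?i k) (?j k)" for k
  have all: "(\<Sum>(i, j)\<in>{1..I} \<times> {1..J}. f i j) = (\<Sum>k=0..<?N. f (?i k) (?j k))"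
    if "f I J = 0" for f :: "nat \<Rightarrow> nat \<Rightarrow> real"
  proof -
    have "(\<Sum>(i, j)\<in>{1..I} \<times> {1..J}. f i j) = (\<Sum>(i, j)\<in>{1..I} \<times> {1..J} - {(I, J)}. f i j)"
      using that by (intro sum.mono_neutral_right) auto
    then show ?thesis using sum_vec_star[OF assms(1,2), of f] by simp
  qed
  have "scalar_prod (vec_star I J d) (Sigma_star I J p *\<^sub>v vec_star I J d)
      = (\<Sum>k=0..<?N. d' k * (\<Sum>l=0..<?N. (if k = l then P k * (1 - P k) else - (P k * P l)) * d' l))"
    by (simp add: scalar_prod_def vec_star_def Sigma_star_def Let_def P_def d'_def cong: if_cong)
  also have "\<dots> = (\<Sum>k=0..<?N. P k * (d' k)\<^sup>2 - P k * d' k * (\<Sum>l=0..<?N. P l * d' l))"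
  proof (intro sum.cong refl)
    fix k assume k: "k \<in> {0..<?N}"
    have "(\<Sum>l=0..<?N. (if k = l then P k * (1 - P k) else - (P k * P l)) * d' l)
        = (\<Sum>l=0..<?N. (if l = k then P k * d' k else 0) - P k * (P l * d' l))"
      by (intro sum.cong) (auto simp: algebra_simps)
    also have "\<dots> = P k * d' k - P k * (\<Sum>l=0..<?N. P l * d' l)"
      using k by (simp add: sum_subtractf sum_distrib_left)
    finally have eq: "(\<Sum>l=0..<?N. (if k = l then P k * (1 - P k) else - (P k * P l)) * d' l)
        = P k * d' k - P k * (\<Sum>l=0..<?N. P l * d' l)" .
    show "d' k * (\<Sum>l=0..<?N. (if k = l then P k * (1 - P k) else - (P k * P l)) * d' l)
        = P k * (d' k)\<^sup>2 - P k * d' k * (\<Sum>l=0..<?N. P l * d' l)"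
      unfolding eq by (simp add: power2_eq_square algebra_simps)
  qed
  also have "\<dots> = (\<Sum>k=0..<?N. P k * (d' k)\<^sup>2) - (\<Sum>k=0..<?N. P k * d' k)\<^sup>2"
    by (simp add: sum_subtractf power2_eq_square flip: sum_distrib_right)
  finally show ?thesis
    using all[of "\<lambda>i j. p i j * (d i j)\<^sup>2"] all[of "\<lambda>i j. p i j * d i j"] d0 by (simp add: P_def d'_def)
qed

lemma vec_star_cong:
  assumes "I \<ge> 1" "J \<ge> 1"
    and "\<And>i j. i \<in> {1..I} \<Longrightarrow> j \<in> {1..J} \<Longrightarrow> (i, j) \<noteq> (I, J) \<Longrightarrow> A i j = B i j"
  shows "vec_star I J A = vec_star I J B"
  unfolding vec_star_def using vec_star_position[OF assms(1,2)] assms(3)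
  by (intro eq_vecI) (simp_all del: One_nat_def)

text \<open>Replaces \<open>deriv\<close> by differences of gradient entries; these vanish at
  \<open>(I, J)\<close>, as the quadratic form lemma demands.\<close>

lemma asymptotic_variance_eq:
  assumes total: "(\<Sum>i=1..I. \<Sum>j=1..J. p i j) = 1" and IJ: "I \<ge> 1" "J \<ge> 1"
  defines "d \<equiv> \<lambda>i j. dependence_grad I J p i j - dependence_grad I J p I J"
  shows "asymptotic_variance I J p
    = (\<Sum>(i, j)\<in>{1..I} \<times> {1..J}. p i j * (d i j)\<^sup>2) - (\<Sum>(i, j)\<in>{1..I} \<times> {1..J}. p i j * d i j)\<^sup>2"
proof -
  have "vec_star I J (D_partial I J p) = vec_star I J d"
    using IJ unfolding D_partial_def d_def
    by (intro vec_star_cong DERIV_imp_deriv D_slice_has_derivative total) auto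
  then show ?thesis
    unfolding asymptotic_variance_def using Sigma_star_quadratic_form[OF IJ, of d p] by (simp add: d_def)
qed

section \<open>The empirical table and the distance between the two estimators\<close>

lemma cell_count_eq_sum:
  "real (cell_count X Y n \<omega> i j) = (\<Sum>k<n. of_bool ((X k \<omega>, Y k \<omega>) = (i, j)))"
proof -
  have "{k. k < n \<and> X k \<omega> = i \<and> Y k \<omega> = j} = {k \<in> {..<n}. (X k \<omega>, Y k \<omega>) = (i, j)}" by auto
  then show ?thesis by (simp add: cell_count_def of_bool_def sum.If_cases Int_def)
qed

lemma empirical_bounds: "0 \<le> empirical X Y n \<omega> i j" "empirical X Y n \<omega> i j \<le> 1"
proof -
  have "cell_count X Y n \<omega> i j \<le> card {..<n}"
    unfolding cell_count_def by (intro card_mono) auto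
  then show "empirical X Y n \<omega> i j \<le> 1"
    \<comment> \<open>For \<open>n = 0\<close> the quotient is 0, by the convention for division by
      zero.\<close>
    by (cases "n = 0") (simp_all add: empirical_def)
qed (simp add: empirical_def)

text \<open>Empirical entries lie between 0 and 1, so all sums in the estimators are bounded
  uniformly in the sample. The coefficients differ by O(1/n), and after multiplication by
  \<open>sqrt n\<close> a deterministic null sequence remains.\<close>

lemma D_tilde_D_hat_diff:
  obtains w where "w \<longlonglongrightarrow> 0"
    and "\<And>X Y n \<omega>. \<bar>sqrt (real n) * (D_tilde I J X Y n \<omega> - D_hat I J X Y n \<omega>)\<bar> \<le> w n"
proof -
  \<comment> \<open>Crude bounds from \<open>|q i j| \<le> 1\<close>, \<open>|r i| \<le> J\<close>
    and \<open>|s j| \<le> I\<close>, summed over the index ranges.\<close>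
  define K1 where "K1 = real I * J * (1 + real I * J)\<^sup>2"
  define K2 where "K2 = real I * J * (J * I)"
  define K3 where "K3 = real I * (real J)\<^sup>2"
  define K4 where "K4 = real J * (real I)\<^sup>2"
  \<comment> \<open>These are the coefficients of the difference of the estimators. They keep the
    quotients of \<open>D_tilde\<close> literally, so the bound by \<open>w\<close> also holds for
    \<open>n < 4\<close>.\<close>
  define a0 where "a0 N = N / (N - 3) - 1" for N :: real
  define a1 where "a1 N = 4 * N / ((N - 2) * (N - 3))" for N :: real
  define a2 where "a2 N = N / ((N - 1) * (N - 3))" for N :: real
  define a3 where "a3 N = N * (3 * N - 2) / ((N - 1) * (N - 2) * (N - 3))" for N :: real
  define w where "w n = \<bar>sqrt (real n) * a0 n\<bar> * K1 + \<bar>sqrt (real n) * a1 n\<bar> * K2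
    + \<bar>sqrt (real n) * a2 n\<bar> * (K3 + K4) + \<bar>sqrt (real n) * a3 n\<bar> * (K3 * K4) + \<bar>sqrt (real n) * a2 n\<bar>" for n
  have "(\<lambda>n. sqrt (real n) * a0 n) \<longlonglongrightarrow> 0" "(\<lambda>n. sqrt (real n) * a1 n) \<longlonglongrightarrow> 0"
    "(\<lambda>n. sqrt (real n) * a2 n) \<longlonglongrightarrow> 0" "(\<lambda>n. sqrt (real n) * a3 n) \<longlonglongrightarrow> 0"
    unfolding a0_def a1_def a2_def a3_def by real_asymp+
  then have "(\<lambda>n. w n) \<longlonglongrightarrow> \<bar>0\<bar> * K1 + \<bar>0\<bar> * K2 + \<bar>0\<bar> * (K3 + K4) + \<bar>0\<bar> * (K3 * K4) + \<bar>0\<bar>"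
    unfolding w_def by (intro tendsto_intros)
  then have "w \<longlonglongrightarrow> 0" by simp
  moreover have "\<bar>sqrt (real n) * (D_tilde I J X Y n \<omega> - D_hat I J X Y n \<omega>)\<bar> \<le> w n"
    for X Y :: "nat \<Rightarrow> 'a \<Rightarrow> nat" and n \<omega>
  proof -
    define q where "q = empirical X Y n \<omega>"
    define r where "r = row_marginal J q"
    define s where "s = col_marginal I q"
    have q: "\<bar>q i j\<bar> \<le> 1" for i j
      using empirical_bounds[of X Y n \<omega> i j] by (simp add: q_def)
    have r: "\<bar>r i\<bar> \<le> J" for i
      unfolding r_def row_marginal_def
      using order_trans[OF sum_abs sum_mono[of "{1..J}" "\<lambda>j. \<bar>q i j\<bar>" "\<lambda>_. 1"]] q by simp
    have s: "\<bar>s j\<bar> \<le> I" for j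
      unfolding s_def col_marginal_def
      using order_trans[OF sum_abs sum_mono[of "{1..I}" "\<lambda>i. \<bar>q i j\<bar>" "\<lambda>_. 1"]] q by simp
    have rs: "\<bar>r i * s j\<bar> \<le> J * I" for i j
      unfolding abs_mult using mult_mono[OF r s] by simp
    have S1: "\<bar>\<Sum>i=1..I. \<Sum>j=1..J. (q i j - r i * s j)\<^sup>2\<bar> \<le> K1"
    proof -
      have "\<bar>q i j - r i * s j\<bar> \<le> \<bar>1 + real I * J\<bar>" for i j
        using abs_triangle_ineq4[of "q i j" "r i * s j"] q[of i j] rs[of i j] by (simp add: mult.commute)
      then have "(q i j - r i * s j)\<^sup>2 \<le> (1 + real I * J)\<^sup>2" for i j
        by (simp only: abs_le_square_iff)
      then have "(\<Sum>i=1..I. \<Sum>j=1..J. (q i j - r i * s j)\<^sup>2) \<le> (\<Sum>i=1..I. \<Sum>j=1..J. (1 + real I * J)\<^sup>2)"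
        by (intro sum_mono)
      then show ?thesis by (simp add: K1_def sum_nonneg mult.assoc)
    qed
    have S2: "\<bar>\<Sum>i=1..I. \<Sum>j=1..J. q i j * r i * s j\<bar> \<le> K2"
    proof -
      have "\<bar>q i j * r i * s j\<bar> \<le> 1 * real (J * I)" for i j
        unfolding mult.assoc abs_mult[of "q i j"] using q rs by (intro mult_mono) auto
      then have "\<bar>\<Sum>i=1..I. \<Sum>j=1..J. q i j * r i * s j\<bar> \<le> (\<Sum>i=1..I. \<Sum>j=1..J. 1 * real (J * I))"
        by (intro order_trans[OF sum_abs] sum_mono) simp
      then show ?thesis by (simp add: K2_def mult.assoc)
    qed
    have S3: "(\<Sum>i=1..I. (r i)\<^sup>2) \<le> K3"
    proof -
      have "(r i)\<^sup>2 \<le> (real J)\<^sup>2" for i using r[of i] by (simp add: abs_le_square_iff[symmetric])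
      then have "(\<Sum>i=1..I. (r i)\<^sup>2) \<le> (\<Sum>i=1..I. (real J)\<^sup>2)" by (intro sum_mono)
      then show ?thesis by (simp add: K3_def)
    qed
    have S4: "(\<Sum>j=1..J. (s j)\<^sup>2) \<le> K4"
    proof -
      have "(s j)\<^sup>2 \<le> (real I)\<^sup>2" for j using s[of j] by (simp add: abs_le_square_iff[symmetric])
      then have "(\<Sum>j=1..J. (s j)\<^sup>2) \<le> (\<Sum>j=1..J. (real I)\<^sup>2)" by (intro sum_mono)
      then show ?thesis by (simp add: K4_def)
    qed
    define s1 where "s1 = (\<Sum>i=1..I. \<Sum>j=1..J. (q i j - r i * s j)\<^sup>2)"
    define s2 where "s2 = (\<Sum>i=1..I. \<Sum>j=1..J. q i j * r i * s j)"
    define s3 where "s3 = (\<Sum>i=1..I. (r i)\<^sup>2)"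
    define s4 where "s4 = (\<Sum>j=1..J. (s j)\<^sup>2)"
    have s3: "0 \<le> s3" "s3 \<le> K3" and s4: "0 \<le> s4" "s4 \<le> K4"
      using S3 S4 by (simp_all add: s3_def s4_def sum_nonneg)
    have bounds: "\<bar>s1\<bar> \<le> K1" "\<bar>s2\<bar> \<le> K2" "\<bar>s3 + s4\<bar> \<le> K3 + K4" "\<bar>s3 * s4\<bar> \<le> K3 * K4"
      using S1 S2 s3 s4 by (simp_all add: s1_def s2_def mult_mono)
    have "D_tilde I J X Y n \<omega> = n / (real n - 3) * s1 - a1 n * s2 + a2 n * (s3 + s4) + a3 n * s3 * s4 - a2 n"
      unfolding D_tilde_def Let_def a1_def a2_def a3_def s1_def s2_def s3_def s4_def r_def s_def q_def ..
    moreover have "D_hat I J X Y n \<omega> = s1"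
      by (simp add: D_hat_def dependence_def s1_def r_def s_def q_def)
    ultimately have "D_tilde I J X Y n \<omega> - D_hat I J X Y n \<omega>
      = a0 n * s1 - a1 n * s2 + a2 n * (s3 + s4) + a3 n * (s3 * s4) - a2 n"
      by (simp add: a0_def left_diff_distrib)
    then have "sqrt n * (D_tilde I J X Y n \<omega> - D_hat I J X Y n \<omega>)
      = sqrt n * a0 n * s1 - sqrt n * a1 n * s2 + sqrt n * a2 n * (s3 + s4)
        + sqrt n * a3 n * (s3 * s4) - sqrt n * a2 n"
      by (simp only:) (simp add: algebra_simps)
    also have "\<bar>\<dots>\<bar> \<le> \<bar>sqrt n * a0 n * s1\<bar> + \<bar>sqrt n * a1 n * s2\<bar> + \<bar>sqrt n * a2 n * (s3 + s4)\<bar>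
        + \<bar>sqrt n * a3 n * (s3 * s4)\<bar> + \<bar>sqrt n * a2 n\<bar>"
      by linarith
    also have "\<dots> \<le> w n"
      unfolding w_def abs_mult[of "_ * _" s1] abs_mult[of "_ * _" s2] abs_mult[of "_ * _" "s3 + s4"]
        abs_mult[of "_ * _" "s3 * s4"]
      using bounds by (intro add_mono mult_left_mono) auto
    finally show ?thesis .
  qed
  ultimately show ?thesis by (rule that)
qed

section \<open>Limit laws of both estimators\<close>

lemma weak_conv_D_hat_D_tilde:
  fixes M :: "'a measure" and X Y :: "nat \<Rightarrow> 'a \<Rightarrow> nat" and p :: "nat \<Rightarrow> nat \<Rightarrow> real"
  assumes "finite_iid M (\<lambda>k \<omega>. (X k \<omega>, Y k \<omega>)) ({1..I} \<times> {1..J}) (\<lambda>(i, j). p i j)"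
  shows "weak_conv_m
      (\<lambda>n. distr M borel (\<lambda>\<omega>. sqrt (real n) * (D_hat I J X Y n \<omega> - dependence I J p)))
      (normal_law 0 (asymptotic_variance I J p))"
    and "weak_conv_m
      (\<lambda>n. distr M borel (\<lambda>\<omega>. sqrt (real n) * (D_tilde I J X Y n \<omega> - dependence I J p)))
      (normal_law 0 (asymptotic_variance I J p))"
proof -
  let ?Z = "\<lambda>k \<omega>. (X k \<omega>, Y k \<omega>)" and ?C = "{1..I} \<times> {1..J}"
  interpret finite_iid M ?Z ?C "\<lambda>(i, j). p i j" by fact
  \<comment> \<open>Keeps the lower bound 1 of the index ranges from being rewritten to
    \<open>Suc 0\<close>.\<close>
  note One_nat_def [simp del]
  define G where "G = (\<lambda>(i, j). dependence_grad I J p i j)"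
  \<comment> \<open>Indicator of a cell: the deviation of an empirical entry from \<open>p\<close>
    is the centred sum of \<open>ind\<close> divided by \<open>n\<close>.\<close>
  define ind where "ind z z' = (of_bool (z' = z) :: real)" for z z' :: "nat \<times> nat"
  have total: "(\<Sum>i=1..I. \<Sum>j=1..J. p i j) = 1"
    using sum_q by (simp add: sum.cartesian_product)
  \<comment> \<open>Without cells, \<open>sum_q\<close> would read 0 = 1.\<close>
  have "?C \<noteq> {}" using sum_q by (metis sum.empty zero_neq_one)
  then have IJ: "I \<ge> 1" "J \<ge> 1" by auto
  have p01: "0 \<le> p i j" "p i j \<le> 1" if "i \<in> {1..I}" "j \<in> {1..J}" for i j
  proof -
    show "0 \<le> p i j" using q_nonneg[of "(i, j)"] that by simp
    have "(\<lambda>(i, j). p i j) (i, j) \<le> (\<Sum>(i, j)\<in>?C. p i j)"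
      using that q_nonneg by (intro member_le_sum) auto
    then show "p i j \<le> 1" using sum_q by simp
  qed
  have mean_ind: "mean (ind z) = (\<lambda>(i, j). p i j) z" if "z \<in> ?C" for z
    unfolding mean_def ind_def using that by (simp add: sum.delta' if_distrib of_bool_def cong: if_cong)
  have var: "mean (\<lambda>z. (G z - mean G)\<^sup>2) = asymptotic_variance I J p"
  proof -
    define g where "g z = G z - dependence_grad I J p I J" for z
    have "mean g = mean G - dependence_grad I J p I J"
      unfolding g_def mean_diff mean_const ..
    then have "mean (\<lambda>z. (G z - mean G)\<^sup>2) = mean (\<lambda>z. (g z - mean g)\<^sup>2)"
      by (simp add: g_def[of "_"])
    also have "\<dots> = asymptotic_variance I J p"
      unfolding mean_square_deviation asymptotic_variance_eq[OF total IJ]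
      by (simp add: mean_def g_def G_def case_prod_beta)
    finally show ?thesis .
  qed
  have dev: "empirical X Y n \<omega> i j - p i j = centered_sum (ind (i, j)) n \<omega> / n"
    if "n > 0" "i \<in> {1..I}" "j \<in> {1..J}" for n \<omega> i j
    using that mean_ind[of "(i, j)"]
    by (simp add: empirical_def cell_count_eq_sum centered_sum_def ind_def sum_subtractf field_simps)
  \<comment> \<open>Weighting the cell indicators by \<open>G\<close> and summing over the cells
    evaluates \<open>G\<close> at each draw.\<close>
  have lin: "(\<Sum>i=1..I. \<Sum>j=1..J. dependence_grad I J p i j * (empirical X Y n \<omega> i j - p i j))
      = centered_sum G n \<omega> / n" if "n > 0" "\<omega> \<in> space M" for n \<omega>
  proof -
    have "(\<Sum>i=1..I. \<Sum>j=1..J. dependence_grad I J p i j * (empirical X Y n \<omega> i j - p i j))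
        = (\<Sum>z\<in>?C. G z * (centered_sum (ind z) n \<omega> / n))"
      unfolding sum.cartesian_product using that by (intro sum.cong) (auto simp: G_def dev)
    also have "\<dots> = (\<Sum>z\<in>?C. \<Sum>k<n. G z * (ind z (?Z k \<omega>) - mean (ind z))) / n"
      by (simp add: centered_sum_def sum_distrib_left sum_divide_distrib)
    also have "(\<Sum>z\<in>?C. \<Sum>k<n. G z * (ind z (?Z k \<omega>) - mean (ind z)))
        = (\<Sum>k<n. \<Sum>z\<in>?C. G z * (ind z (?Z k \<omega>) - mean (ind z)))"
      by (rule sum.swap)
    also have "\<dots> = centered_sum G n \<omega>"
      unfolding centered_sum_def
    proof (intro sum.cong refl)
      fix k
      have "(\<Sum>z\<in>?C. G z * ind z (?Z k \<omega>)) = (\<Sum>z\<in>?C. if z = ?Z k \<omega> then G z else 0)"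
        by (intro sum.cong) (auto simp: ind_def)
      also have "\<dots> = G (?Z k \<omega>)" using Z_in[OF that(2), of k] by simp
      moreover have "(\<Sum>z\<in>?C. G z * mean (ind z)) = mean G"
        unfolding mean_def[of G] by (intro sum.cong) (auto simp: mean_ind)
      ultimately show "(\<Sum>z\<in>?C. G z * (ind z (?Z k \<omega>) - mean (ind z))) = G (?Z k \<omega>) - mean G"
        by (simp add: right_diff_distrib sum_subtractf)
    qed
    finally show ?thesis .
  qed
  obtain K where K: "\<And>e. (\<And>i j. i \<in> {1..I} \<Longrightarrow> j \<in> {1..J} \<Longrightarrow> \<bar>e i j\<bar> \<le> 1) \<Longrightarrow>
    \<bar>dependence I J (\<lambda>i j. p i j + e i j) - dependence I J p
      - (\<Sum>i=1..I. \<Sum>j=1..J. dependence_grad I J p i j * e i j)\<bar>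
    \<le> K * (\<Sum>i=1..I. \<Sum>j=1..J. (e i j)\<^sup>2)"
    using dependence_remainder by blast
  \<comment> \<open>The remainder bound \<open>K * (\<Sum> e^2)\<close> times \<open>sqrt n\<close>:
    each deviation is a centred sum over \<open>n\<close>, and
    \<open>sqrt n / n^2 = 1 / (n * sqrt n)\<close>. The second moments grow like \<open>n\<close>,
    so the mean of \<open>W n\<close> is of order \<open>1 / sqrt n\<close>.\<close>
  define W where "W n \<omega> = K / (n * sqrt n) * (\<Sum>z\<in>?C. (centered_sum (ind z) n \<omega>)\<^sup>2)" for n \<omega>
  define V where "V = (\<Sum>z\<in>?C. mean (\<lambda>z'. (ind z z' - mean (ind z))\<^sup>2))"
  have W_int: "integrable M (W n)" for n
    unfolding W_def by (intro integrable_mult_right Bochner_Integration.integrable_sum integrable_centered_sum_square)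
  have "expectation (W n) = K * V / sqrt n" for n
    unfolding W_def
    by (simp add: Bochner_Integration.integral_sum integrable_centered_sum_square
        expectation_centered_sum_square V_def flip: sum_distrib_left)
  moreover have "(\<lambda>n. K * V / sqrt (real n)) \<longlonglongrightarrow> 0" by real_asymp
  ultimately have W_lim: "(\<lambda>n. expectation (W n)) \<longlonglongrightarrow> 0" by simp
  have close: "\<bar>sqrt n * (D_hat I J X Y n \<omega> - dependence I J p) - centered_sum G n \<omega> / sqrt n\<bar> \<le> W n \<omega>"
    if n: "n > 0" and \<omega>: "\<omega> \<in> space M" for n \<omega>
  proof -
    define e where "e i j = empirical X Y n \<omega> i j - p i j" for i j
    have "\<bar>e i j\<bar> \<le> 1" if "i \<in> {1..I}" "j \<in> {1..J}" for i j
      using p01[OF that] empirical_bounds[of X Y n \<omega> i j] by (simp add: e_def)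
    from K[of e, OF this] have "\<bar>D_hat I J X Y n \<omega> - dependence I J p - centered_sum G n \<omega> / n\<bar>
        \<le> K * (\<Sum>i=1..I. \<Sum>j=1..J. (e i j)\<^sup>2)"
      using lin[OF that] by (simp add: e_def D_hat_def)
    also have "(\<Sum>i=1..I. \<Sum>j=1..J. (e i j)\<^sup>2) = (\<Sum>z\<in>?C. (centered_sum (ind z) n \<omega> / n)\<^sup>2)"
      unfolding sum.cartesian_product using n by (intro sum.cong) (auto simp: e_def dev)
    also have "\<dots> = (\<Sum>z\<in>?C. (centered_sum (ind z) n \<omega>)\<^sup>2) / n\<^sup>2"
      by (simp add: power_divide sum_divide_distrib)
    finally have "sqrt n * \<bar>D_hat I J X Y n \<omega> - dependence I J p - centered_sum G n \<omega> / n\<bar>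
        \<le> sqrt n * (K * ((\<Sum>z\<in>?C. (centered_sum (ind z) n \<omega>)\<^sup>2) / n\<^sup>2))"
      by (intro mult_left_mono) auto
    moreover have sq: "sqrt n / n = 1 / sqrt n" "sqrt n / n\<^sup>2 = 1 / (n * sqrt n)"
      using n by (simp_all add: field_simps power2_eq_square)
    have "sqrt n * \<bar>D_hat I J X Y n \<omega> - dependence I J p - centered_sum G n \<omega> / n\<bar>
        = \<bar>sqrt n * (D_hat I J X Y n \<omega> - dependence I J p) - centered_sum G n \<omega> * (sqrt n / n)\<bar>"
      using abs_mult[of "sqrt n" "D_hat I J X Y n \<omega> - dependence I J p - centered_sum G n \<omega> / n"]
      by (simp add: right_diff_distrib mult_ac)
    moreover have "sqrt n * (K * ((\<Sum>z\<in>?C. (centered_sum (ind z) n \<omega>)\<^sup>2) / n\<^sup>2))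
        = K * (sqrt n / n\<^sup>2) * (\<Sum>z\<in>?C. (centered_sum (ind z) n \<omega>)\<^sup>2)"
      by simp
    ultimately show ?thesis unfolding W_def sq by simp
  qed
  have meas_emp [measurable]: "(\<lambda>\<omega>. empirical X Y n \<omega> i j) \<in> borel_measurable M" for n i j
    unfolding empirical_def cell_count_eq_sum
    using borel_measurable_Z[of "ind (i, j)"] unfolding ind_def by measurable
  have meas_hat [measurable]: "(\<lambda>\<omega>. D_hat I J X Y n \<omega>) \<in> borel_measurable M" for n
    unfolding D_hat_def dependence_def row_marginal_def col_marginal_def by measurable
  have meas_tilde [measurable]: "(\<lambda>\<omega>. D_tilde I J X Y n \<omega>) \<in> borel_measurable M" for n
    unfolding D_tilde_def Let_def row_marginal_def col_marginal_def by measurable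
  show "weak_conv_m
      (\<lambda>n. distr M borel (\<lambda>\<omega>. sqrt (real n) * (D_hat I J X Y n \<omega> - dependence I J p)))
      (normal_law 0 (asymptotic_variance I J p))"
    unfolding var[symmetric]
  proof (rule delta_method[OF _ W_int _ W_lim])
    show "\<forall>\<^sub>F n in sequentially. \<forall>\<omega>\<in>space M.
      \<bar>sqrt n * (D_hat I J X Y n \<omega> - dependence I J p) - centered_sum G n \<omega> / sqrt n\<bar> \<le> W n \<omega>"
      using eventually_gt_at_top[of 0] by eventually_elim (use close in blast)
  qed measurable
  obtain w where w: "w \<longlonglongrightarrow> 0"
    and w_bound: "\<And>X Y n (\<omega> :: 'a). \<bar>sqrt (real n) * (D_tilde I J X Y n \<omega> - D_hat I J X Y n \<omega>)\<bar> \<le> w n"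
    using D_tilde_D_hat_diff by blast
  show "weak_conv_m
      (\<lambda>n. distr M borel (\<lambda>\<omega>. sqrt (real n) * (D_tilde I J X Y n \<omega> - dependence I J p)))
      (normal_law 0 (asymptotic_variance I J p))"
    unfolding var[symmetric]
  \<comment> \<open>The same centred sum approximates both estimators; the error only gains the
    deterministic \<open>w n\<close>.\<close>
  proof (rule delta_method)
    show "integrable M (\<lambda>\<omega>. W n \<omega> + w n)" for n
      using W_int by simp
    have "expectation (\<lambda>\<omega>. W n \<omega> + w n) = expectation (W n) + w n" for n
      using W_int by (simp add: prob_space)
    then show "(\<lambda>n. expectation (\<lambda>\<omega>. W n \<omega> + w n)) \<longlonglongrightarrow> 0"
      using tendsto_add[OF W_lim w] by simp
    show "\<forall>\<^sub>F n in sequentially. \<forall>\<omega>\<in>space M.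
      \<bar>sqrt n * (D_tilde I J X Y n \<omega> - dependence I J p) - centered_sum G n \<omega> / sqrt n\<bar> \<le> W n \<omega> + w n"
      using eventually_gt_at_top[of 0]
    proof eventually_elim
      case (elim n)
      show ?case
      proof
        fix \<omega> assume "\<omega> \<in> space M"
        from close[OF elim this] w_bound[of n X Y \<omega>]
        show "\<bar>sqrt n * (D_tilde I J X Y n \<omega> - dependence I J p) - centered_sum G n \<omega> / sqrt n\<bar> \<le> W n \<omega> + w n"
          unfolding right_diff_distrib by linarith
      qed
    qed
  qed measurable
qed

theorem theorem2:
  fixes M :: "'a measure"
    and X Y :: "nat \<Rightarrow> 'a \<Rightarrow> nat"
    and I J :: nat
    and p c :: "nat \<Rightarrow> nat \<Rightarrow> real"
  assumes "prob_space M"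
    and indep: "prob_space.indep_vars M (\<lambda>_. count_space ({1..I} \<times> {1..J}))
                  (\<lambda>k \<omega>. (X k \<omega>, Y k \<omega>)) UNIV"
    and law: "\<And>k i j. i \<in> {1..I} \<Longrightarrow> j \<in> {1..J} \<Longrightarrow>
                measure M {\<omega> \<in> space M. X k \<omega> = i \<and> Y k \<omega> = j} = p i j"
    and alternative: "\<And>i j. i \<in> {1..I} \<Longrightarrow> j \<in> {1..J} \<Longrightarrow>
                p i j = row_marginal J p i * col_marginal I p j + c i j"
    and c_sum: "(\<Sum>i=1..I. \<Sum>j=1..J. c i j) = 0"
    and c_max: "(MAX (i, j)\<in>{1..I} \<times> {1..J}. \<bar>c i j\<bar>) > 0"
  shows "weak_conv_m
           (\<lambda>n. distr M borel (\<lambda>\<omega>. sqrt (real n) * (D_hat I J X Y n \<omega> - dependence I J p)))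
           (normal_law 0 (asymptotic_variance I J p))
       \<and> weak_conv_m
           (\<lambda>n. distr M borel (\<lambda>\<omega>. sqrt (real n) * (D_tilde I J X Y n \<omega> - dependence I J p)))
           (normal_law 0 (asymptotic_variance I J p))
       \<and> (\<forall>i\<in>{1..<I}. \<forall>j\<in>{1..<J}.
            (D_slice I J p i j has_real_derivative
               2 * (\<Sum>m=1..I. row_marginal J p m * c m J)
               + 2 * (\<Sum>k=1..J. col_marginal I p k * c I k)
               - 2 * (\<Sum>m=1..I. row_marginal J p m * c m j)
               - 2 * (\<Sum>k=1..J. col_marginal I p k * c i k)
               + 2 * c i j - 2 * c I J) (at (p i j)))
       \<and> (\<forall>j\<in>{1..<J}.
            (D_slice I J p I j has_real_derivative
               2 * (\<Sum>m=1..I. row_marginal J p m * c m J)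
               - 2 * (\<Sum>m=1..I. row_marginal J p m * c m j)
               + 2 * c I j - 2 * c I J) (at (p I j)))
       \<and> (\<forall>i\<in>{1..<I}.
            (D_slice I J p i J has_real_derivative
               2 * (\<Sum>k=1..J. col_marginal I p k * c I k)
               - 2 * (\<Sum>k=1..J. col_marginal I p k * c i k)
               + 2 * c i J - 2 * c I J) (at (p i J)))"
proof -
  interpret prob_space M by fact
  interpret finite_iid M "\<lambda>k \<omega>. (X k \<omega>, Y k \<omega>)" "{1..I} \<times> {1..J}" "\<lambda>(i, j). p i j"
    using indep law by unfold_locales auto
  have total: "(\<Sum>i=1..I. \<Sum>j=1..J. p i j) = 1"
    using sum_q by (simp add: sum.cartesian_product)
  have "{1..I} \<times> {1..J} \<noteq> {}" using sum_q by (metis sum.empty zero_neq_one)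
  then have IJ: "I \<in> {1..I}" "J \<in> {1..J}" by auto
  have res: "residual I J p i j = c i j" if "i \<in> {1..I}" "j \<in> {1..J}" for i j
    using alternative[OF that] by (simp add: residual_def)
  have grad: "dependence_grad I J p i j = 2 * (c i j
      - (\<Sum>m=1..I. row_marginal J p m * c m j) - (\<Sum>k=1..J. col_marginal I p k * c i k))"
    if "i \<in> {1..I}" "j \<in> {1..J}" for i j
    using that by (simp add: dependence_grad_def res)
  \<comment> \<open>One difference of gradient entries covers the three cases: for
    \<open>i = I\<close> the sums over \<open>k\<close> cancel, for \<open>j = J\<close> those over
    \<open>m\<close>. The free \<open>D\<close> leaves the match with each closed form to
    algebra.\<close>
  have der: "(D_slice I J p i j has_real_derivative D) (at (p i j))"
    if "i \<in> {1..I}" "j \<in> {1..J}" "(i, j) \<noteq> (I, J)"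
      "D = dependence_grad I J p i j - dependence_grad I J p I J" for i j D
    using D_slice_has_derivative[OF total that(1-3)] that(4) by simp
  show ?thesis
    using IJ by (intro conjI ballI weak_conv_D_hat_D_tilde[OF finite_iid_axioms] der)
      (auto simp: grad algebra_simps)
qed

end
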